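(* Let $A_1,\dots,A_n,A$ be formulas of $LM2$. If $A_1,\dots,A_n\vdash_{LM2}A$, then $A_1^*,\dots,A_n^*\vdash_{LAF2}A^*$.
   Context: Formulas: second-order predicate logic built from $\perp$ and atomic formulas $R(t_1,\dots,t_k)$ ($R$ a predicate symbol or predicate variable, $t_i$ first-order terms) with $\rightarrow,\forall x,\forall X$; $\neg A=A\rightarrow\perp$; equations $u=v$ abbreviate $\forall Y(Y(u)\rightarrow Y(v))$, a fixed set of equations is given and $a\approx b$ means $a=b$ is a consequence of it. $LAF2$ is second-order intuitionistic natural deduction with rules: hypothesis, $\rightarrow$-intro/elim, $\forall x$-intro (eigenvariable condition)/elim (any term), $\forall X$-intro (eigenvariable)/elim (any formula), and the equational rule (from $A[u/x]$ and $u\approx v$ derive $A[v/x]$). $LM2$ has, in addition, for each arity a countable set of classical predicate variables $X_C$; a formula ends with $X$ if it is $X(\vec t)$, or $A\rightarrow B$ with $B$ ending with $X$, or $\forall vA$ with $A$ ending with $X$; a classical type is a formula ending with $\perp$ or a classical variable. $LM2$ = rules of $LAF2$ plus the axiom $\forall X_C\{\neg\neg X_C\rightarrow X_C\}$, $\forall X_C$-introduction (eigenvariable condition) and $\forall X_C$-elimination instantiating $X_C$ only by classical types. Gödel translation: to each classical variable $X_C$ associate a fresh ordinary predicate variable $X^*$ of the same arity; for a formula $A$ of $LM2$ define $A^*$ by: $D(\vec t)^*=D(\vec t)$ for $D$ a predicate symbol, ordinary predicate variable, or $\perp$; $X_C(\vec t)^*=\neg X^*(\vec t)$; $(B\rightarrow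 C)^*=B^*\rightarrow C^*$; $(\forall xB)^*=\forall xB^*$; $(\forall XB)^*=\forall XB^*$; $(\forall X_CB)^*=\forall X^*B^*$. *)

theory Defs
  imports Main
begin

section \<open>Syntax\<close>

text \<open>
  Formulas are taken up to renaming of bound variables, by means of de Bruijn indices.
  First-order variables form one index space. Predicate variables have one index space for
  each sort (ordinary or classical) and each arity: the variable with sort \<open>s\<close>, arity \<open>k\<close> and
  index \<open>n\<close> is written \<open>(s, k, n)\<close> below. An atom \<open>PVar s n ts\<close> is the variable
  \<open>(s, length ts, n)\<close> applied to \<open>ts\<close>, so that predicate variables are always applied to the
  right number of terms. \<open>AllP s k\<close> binds index \<open>0\<close> of the space of sort \<open>s\<close> and arity \<open>k\<close>,
  and leaves the other spaces alone.
\<close>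

datatype 'f tm = Var nat | Fn 'f "'f tm list"

datatype psort = Ordinary | Classical

datatype ('f, 'p) fm =
    Bot
  | Pred 'p "'f tm list"
  | PVar psort nat "'f tm list"
  | Imp "('f, 'p) fm" "('f, 'p) fm"
  | AllT "('f, 'p) fm"
  | AllP psort nat "('f, 'p) fm"

abbreviation Neg :: "('f, 'p) fm \<Rightarrow> ('f, 'p) fm" where
  "Neg A \<equiv> Imp A Bot"

text \<open>
  \<open>arf\<close> and \<open>arp\<close> are the arities of the function and predicate symbols of the language.
\<close>

fun is_tm :: "('f \<Rightarrow> nat) \<Rightarrow> 'f tm \<Rightarrow> bool" where
  "is_tm arf (Var i) \<longleftrightarrow> True"
| "is_tm arf (Fn f ts) \<longleftrightarrow> length ts = arf f \<and> (\<forall>t \<in> set ts. is_tm arf t)"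

fun lm2_fm :: "('f \<Rightarrow> nat) \<Rightarrow> ('p \<Rightarrow> nat) \<Rightarrow> ('f, 'p) fm \<Rightarrow> bool" where
  "lm2_fm arf arp Bot \<longleftrightarrow> True"
| "lm2_fm arf arp (Pred P ts) \<longleftrightarrow> length ts = arp P \<and> (\<forall>t \<in> set ts. is_tm arf t)"
| "lm2_fm arf arp (PVar s n ts) \<longleftrightarrow> (\<forall>t \<in> set ts. is_tm arf t)"
| "lm2_fm arf arp (Imp A B) \<longleftrightarrow> lm2_fm arf arp A \<and> lm2_fm arf arp B"
| "lm2_fm arf arp (AllT A) \<longleftrightarrow> lm2_fm arf arp A"
| "lm2_fm arf arp (AllP s k A) \<longleftrightarrow> lm2_fm arf arp A"

fun no_classical :: "('f, 'p) fm \<Rightarrow> bool" where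
  "no_classical Bot \<longleftrightarrow> True"
| "no_classical (Pred P ts) \<longleftrightarrow> True"
| "no_classical (PVar s n ts) \<longleftrightarrow> s = Ordinary"
| "no_classical (Imp A B) \<longleftrightarrow> no_classical A \<and> no_classical B"
| "no_classical (AllT A) \<longleftrightarrow> no_classical A"
| "no_classical (AllP s k A) \<longleftrightarrow> s = Ordinary \<and> no_classical A"

definition laf2_fm :: "('f \<Rightarrow> nat) \<Rightarrow> ('p \<Rightarrow> nat) \<Rightarrow> ('f, 'p) fm \<Rightarrow> bool" where
  "laf2_fm arf arp A \<longleftrightarrow> lm2_fm arf arp A \<and> no_classical A"

fun vars_tm :: "'f tm \<Rightarrow> nat set" where
  "vars_tm (Var i) = {i}"
| "vars_tm (Fn f ts) = (\<Union>t \<in> set ts. vars_tm t)"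

fun free_pvars :: "('f, 'p) fm \<Rightarrow> (psort \<times> nat \<times> nat) set" where
  "free_pvars Bot = {}"
| "free_pvars (Pred P ts) = {}"
| "free_pvars (PVar s n ts) = {(s, length ts, n)}"
| "free_pvars (Imp A B) = free_pvars A \<union> free_pvars B"
| "free_pvars (AllT A) = free_pvars A"
| "free_pvars (AllP s k A) =
     {(s', k', n). (s', k', if s' = s \<and> k' = k then Suc n else n) \<in> free_pvars A}"

section \<open>Substitution\<close>

primrec subst_tm :: "(nat \<Rightarrow> 'f tm) \<Rightarrow> 'f tm \<Rightarrow> 'f tm" where
  "subst_tm \<sigma> (Var i) = \<sigma> i"
| "subst_tm \<sigma> (Fn f ts) = Fn f (map (subst_tm \<sigma>) ts)"

definition up_tm :: "(nat \<Rightarrow> 'f tm) \<Rightarrow> nat \<Rightarrow> 'f tm" where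
  "up_tm \<sigma> = case_nat (Var 0) (\<lambda>i. subst_tm (\<lambda>j. Var (Suc j)) (\<sigma> i))"

fun subst_fm :: "(nat \<Rightarrow> 'f tm) \<Rightarrow> ('f, 'p) fm \<Rightarrow> ('f, 'p) fm" where
  "subst_fm \<sigma> Bot = Bot"
| "subst_fm \<sigma> (Pred P ts) = Pred P (map (subst_tm \<sigma>) ts)"
| "subst_fm \<sigma> (PVar s n ts) = PVar s n (map (subst_tm \<sigma>) ts)"
| "subst_fm \<sigma> (Imp A B) = Imp (subst_fm \<sigma> A) (subst_fm \<sigma> B)"
| "subst_fm \<sigma> (AllT A) = AllT (subst_fm (up_tm \<sigma>) A)"
| "subst_fm \<sigma> (AllP s k A) = AllP s k (subst_fm \<sigma> A)"

definition lift_t :: "('f, 'p) fm \<Rightarrow> ('f, 'p) fm" where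
  "lift_t = subst_fm (\<lambda>i. Var (Suc i))"

text \<open>\<open>inst_t t A\<close> is \<open>A[t/x]\<close>, where \<open>x\<close> is the first-order variable \<open>0\<close> of \<open>A\<close>.\<close>

definition inst_t :: "'f tm \<Rightarrow> ('f, 'p) fm \<Rightarrow> ('f, 'p) fm" where
  "inst_t t = subst_fm (case_nat t Var)"

text \<open>Renaming of predicate variables; sort and arity are preserved.\<close>

definition up_ren :: "psort \<Rightarrow> nat \<Rightarrow> (psort \<Rightarrow> nat \<Rightarrow> nat \<Rightarrow> nat) \<Rightarrow> psort \<Rightarrow> nat \<Rightarrow> nat \<Rightarrow> nat" where
  "up_ren s k \<rho> s' k' n =
     (if s' = s \<and> k' = k then (case n of 0 \<Rightarrow> 0 | Suc m \<Rightarrow> Suc (\<rho> s k m)) else \<rho> s' k' n)"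

fun ren_p :: "(psort \<Rightarrow> nat \<Rightarrow> nat \<Rightarrow> nat) \<Rightarrow> ('f, 'p) fm \<Rightarrow> ('f, 'p) fm" where
  "ren_p \<rho> Bot = Bot"
| "ren_p \<rho> (Pred P ts) = Pred P ts"
| "ren_p \<rho> (PVar s n ts) = PVar s (\<rho> s (length ts) n) ts"
| "ren_p \<rho> (Imp A B) = Imp (ren_p \<rho> A) (ren_p \<rho> B)"
| "ren_p \<rho> (AllT A) = AllT (ren_p \<rho> A)"
| "ren_p \<rho> (AllP s k A) = AllP s k (ren_p (up_ren s k \<rho>) A)"

definition lift_p :: "psort \<Rightarrow> nat \<Rightarrow> ('f, 'p) fm \<Rightarrow> ('f, 'p) fm" where
  "lift_p s k = ren_p (\<lambda>s' k' n. if s' = s \<and> k' = k then Suc n else n)"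

text \<open>
  A predicate variable of arity \<open>k\<close> is replaced by an abstraction
  \<open>\<lambda>x\<^sub>1 \<dots> x\<^sub>k. G\<close>, which is represented by the formula \<open>G\<close>: its first-order variables
  \<open>0, \<dots>, k - 1\<close> are the parameters \<open>x\<^sub>1, \<dots>, x\<^sub>k\<close>, and its first-order variable \<open>k + i\<close> is the
  variable \<open>i\<close> of the context.
\<close>

definition app_abs :: "('f, 'p) fm \<Rightarrow> 'f tm list \<Rightarrow> ('f, 'p) fm" where
  "app_abs G ts = subst_fm (\<lambda>i. if i < length ts then ts ! i else Var (i - length ts)) G"

definition lift_abs :: "nat \<Rightarrow> ('f, 'p) fm \<Rightarrow> ('f, 'p) fm" where
  "lift_abs k = subst_fm (\<lambda>i. Var (if i < k then i else Suc i))"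

text \<open>The predicate variable \<open>(s, k, n)\<close> itself, as an abstraction.\<close>

definition pvar_abs :: "psort \<Rightarrow> nat \<Rightarrow> nat \<Rightarrow> ('f, 'p) fm" where
  "pvar_abs s k n = PVar s n (map Var [0..<k])"

definition up_p :: "psort \<Rightarrow> nat \<Rightarrow> (psort \<Rightarrow> nat \<Rightarrow> nat \<Rightarrow> ('f, 'p) fm) \<Rightarrow>
    psort \<Rightarrow> nat \<Rightarrow> nat \<Rightarrow> ('f, 'p) fm" where
  "up_p s k \<theta> s' k' n =
     (if s' = s \<and> k' = k
      then (case n of 0 \<Rightarrow> pvar_abs s k 0 | Suc m \<Rightarrow> lift_p s k (\<theta> s k m))
      else lift_p s k (\<theta> s' k' n))"

fun subst_p :: "(psort \<Rightarrow> nat \<Rightarrow> nat \<Rightarrow> ('f, 'p) fm) \<Rightarrow> ('f, 'p) fm \<Rightarrow> ('f, 'p) fm" where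
  "subst_p \<theta> Bot = Bot"
| "subst_p \<theta> (Pred P ts) = Pred P ts"
| "subst_p \<theta> (PVar s n ts) = app_abs (\<theta> s (length ts) n) ts"
| "subst_p \<theta> (Imp A B) = Imp (subst_p \<theta> A) (subst_p \<theta> B)"
| "subst_p \<theta> (AllT A) = AllT (subst_p (\<lambda>s k n. lift_abs k (\<theta> s k n)) A)"
| "subst_p \<theta> (AllP s k A) = AllP s k (subst_p (up_p s k \<theta>) A)"

text \<open>
  \<open>inst_p s k G A\<close> is \<open>A[G/X x\<^sub>1\<dots>x\<^sub>k]\<close>, where \<open>X\<close> is the predicate variable \<open>(s, k, 0)\<close> of \<open>A\<close>.
\<close>

definition inst_p :: "psort \<Rightarrow> nat \<Rightarrow> ('f, 'p) fm \<Rightarrow> ('f, 'p) fm \<Rightarrow> ('f, 'p) fm" where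
  "inst_p s k G = subst_p (\<lambda>s' k' n.
     if s' = s \<and> k' = k then (case n of 0 \<Rightarrow> G | Suc m \<Rightarrow> pvar_abs s k m)
     else pvar_abs s' k' n)"

section \<open>The system LAF2\<close>

text \<open>
  The eigenvariable conditions are expressed by lifting the hypotheses: the quantified variable
  is index \<open>0\<close> in the premise, and the lifted hypotheses do not contain it. The parameter \<open>R\<close> is
  the relation on terms used by the equational rule.
\<close>

inductive laf2 :: "('f \<Rightarrow> nat) \<Rightarrow> ('p \<Rightarrow> nat) \<Rightarrow> ('f tm \<Rightarrow> 'f tm \<Rightarrow> bool) \<Rightarrow>
    ('f, 'p) fm list \<Rightarrow> ('f, 'p) fm \<Rightarrow> bool"
  for arf :: "'f \<Rightarrow> nat" and arp :: "'p \<Rightarrow> nat" and R :: "'f tm \<Rightarrow> 'f tm \<Rightarrow> bool" where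
  hyp: "A \<in> set \<Gamma> \<Longrightarrow> \<forall>B \<in> set \<Gamma>. laf2_fm arf arp B \<Longrightarrow> laf2 arf arp R \<Gamma> A"
| impI: "laf2 arf arp R (A # \<Gamma>) B \<Longrightarrow> laf2 arf arp R \<Gamma> (Imp A B)"
| impE: "laf2 arf arp R \<Gamma> (Imp A B) \<Longrightarrow> laf2 arf arp R \<Gamma> A \<Longrightarrow> laf2 arf arp R \<Gamma> B"
| allTI: "laf2 arf arp R (map lift_t \<Gamma>) A \<Longrightarrow> laf2 arf arp R \<Gamma> (AllT A)"
| allTE: "laf2 arf arp R \<Gamma> (AllT A) \<Longrightarrow> is_tm arf t \<Longrightarrow> laf2 arf arp R \<Gamma> (inst_t t A)"
| allPI: "laf2 arf arp R (map (lift_p Ordinary k) \<Gamma>) A \<Longrightarrow> laf2 arf arp R \<Gamma> (AllP Ordinary k A)"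
| allPE: "laf2 arf arp R \<Gamma> (AllP Ordinary k A) \<Longrightarrow> laf2_fm arf arp G \<Longrightarrow>
    laf2 arf arp R \<Gamma> (inst_p Ordinary k G A)"
| eq: "laf2 arf arp R \<Gamma> (inst_t u A) \<Longrightarrow> R u v \<Longrightarrow> laf2 arf arp R \<Gamma> (inst_t v A)"

text \<open>\<open>u = v\<close> is \<open>\<forall>Y (Y(u) \<rightarrow> Y(v))\<close>.\<close>

definition Eq :: "'f tm \<Rightarrow> 'f tm \<Rightarrow> ('f, 'p) fm" where
  "Eq u v = AllP Ordinary 1 (Imp (PVar Ordinary 0 [u]) (PVar Ordinary 0 [v]))"

text \<open>
  The variables of the given equations are understood as universally quantified; \<open>eq_closures E\<close>
  are the universal closures of the equations in \<open>E\<close>. The relation \<open>a \<approx> b\<close> says that \<open>a = b\<close>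
  follows from them in pure second-order logic, that is, when the equational rule is made trivial
  by taking the identity for \<open>R\<close>.
\<close>

definition eq_closures :: "('f tm \<times> 'f tm) set \<Rightarrow> ('f, 'p) fm set" where
  "eq_closures E =
     {(AllT ^^ m) (Eq u v) | m u v. (u, v) \<in> E \<and> vars_tm u \<union> vars_tm v \<subseteq> {..<m}}"

definition eq_conseq :: "('f \<Rightarrow> nat) \<Rightarrow> ('p \<Rightarrow> nat) \<Rightarrow> ('f tm \<times> 'f tm) set \<Rightarrow>
    'f tm \<Rightarrow> 'f tm \<Rightarrow> bool" where
  "eq_conseq arf arp E a b \<longleftrightarrow>
     (\<exists>\<Gamma>. set \<Gamma> \<subseteq> eq_closures E \<and> laf2 arf arp (=) \<Gamma> (Eq a b))"

definition LAF2 :: "('f \<Rightarrow> nat) \<Rightarrow> ('p \<Rightarrow> nat) \<Rightarrow> ('f tm \<times> 'f tm) set \<Rightarrow>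
    ('f, 'p) fm list \<Rightarrow> ('f, 'p) fm \<Rightarrow> bool" where
  "LAF2 arf arp E = laf2 arf arp (eq_conseq arf arp E)"

section \<open>The system LM2\<close>

fun ending :: "('f, 'p) fm \<Rightarrow> ('f, 'p) fm" where
  "ending (Imp A B) = ending B"
| "ending (AllT A) = ending A"
| "ending (AllP s k A) = ending A"
| "ending A = A"

definition classical_type :: "('f, 'p) fm \<Rightarrow> bool" where
  "classical_type A \<longleftrightarrow> ending A = Bot \<or> (\<exists>n ts. ending A = PVar Classical n ts)"

text \<open>In the axiom \<open>\<forall>X\<^sub>C(\<not>\<not>X\<^sub>C \<rightarrow> X\<^sub>C)\<close>, the classical variable has arity \<open>0\<close>.\<close>

inductive LM2 :: "('f \<Rightarrow> nat) \<Rightarrow> ('p \<Rightarrow> nat) \<Rightarrow> ('f tm \<times> 'f tm) set \<Rightarrow>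
    ('f, 'p) fm list \<Rightarrow> ('f, 'p) fm \<Rightarrow> bool"
  for arf :: "'f \<Rightarrow> nat" and arp :: "'p \<Rightarrow> nat" and E :: "('f tm \<times> 'f tm) set" where
  hyp: "A \<in> set \<Gamma> \<Longrightarrow> \<forall>B \<in> set \<Gamma>. lm2_fm arf arp B \<Longrightarrow> LM2 arf arp E \<Gamma> A"
| impI: "LM2 arf arp E (A # \<Gamma>) B \<Longrightarrow> LM2 arf arp E \<Gamma> (Imp A B)"
| impE: "LM2 arf arp E \<Gamma> (Imp A B) \<Longrightarrow> LM2 arf arp E \<Gamma> A \<Longrightarrow> LM2 arf arp E \<Gamma> B"
| allTI: "LM2 arf arp E (map lift_t \<Gamma>) A \<Longrightarrow> LM2 arf arp E \<Gamma> (AllT A)"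
| allTE: "LM2 arf arp E \<Gamma> (AllT A) \<Longrightarrow> is_tm arf t \<Longrightarrow> LM2 arf arp E \<Gamma> (inst_t t A)"
| allPI: "LM2 arf arp E (map (lift_p Ordinary k) \<Gamma>) A \<Longrightarrow> LM2 arf arp E \<Gamma> (AllP Ordinary k A)"
| allPE: "LM2 arf arp E \<Gamma> (AllP Ordinary k A) \<Longrightarrow> lm2_fm arf arp G \<Longrightarrow>
    LM2 arf arp E \<Gamma> (inst_p Ordinary k G A)"
| eq: "LM2 arf arp E \<Gamma> (inst_t u A) \<Longrightarrow> eq_conseq arf arp E u v \<Longrightarrow> LM2 arf arp E \<Gamma> (inst_t v A)"
| dneg: "\<forall>B \<in> set \<Gamma>. lm2_fm arf arp B \<Longrightarrow>
    LM2 arf arp E \<Gamma>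
      (AllP Classical 0 (Imp (Neg (Neg (PVar Classical 0 []))) (PVar Classical 0 [])))"
| allCI: "LM2 arf arp E (map (lift_p Classical k) \<Gamma>) A \<Longrightarrow> LM2 arf arp E \<Gamma> (AllP Classical k A)"
| allCE: "LM2 arf arp E \<Gamma> (AllP Classical k A) \<Longrightarrow> lm2_fm arf arp G \<Longrightarrow> classical_type G \<Longrightarrow>
    LM2 arf arp E \<Gamma> (inst_p Classical k G A)"

section \<open>The Goedel translation\<close>

text \<open>
  In \<open>godel \<rho> A\<close>, the map \<open>\<rho>\<close> gives the index \<open>\<rho> s k n\<close> of the ordinary variable of arity \<open>k\<close> that
  stands for \<open>(s, k, n)\<close>. Since ordinary and classical variables have separate index spaces but
  both become ordinary ones, each predicate quantifier of arity \<open>k\<close>, of either sort, turns into a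
  binder of the ordinary space of arity \<open>k\<close>: the variable it binds becomes index \<open>0\<close>, and every
  other variable of arity \<open>k\<close> is moved up by one.
\<close>

definition up_godel :: "psort \<Rightarrow> nat \<Rightarrow> (psort \<Rightarrow> nat \<Rightarrow> nat \<Rightarrow> nat) \<Rightarrow>
    psort \<Rightarrow> nat \<Rightarrow> nat \<Rightarrow> nat" where
  "up_godel s k \<rho> s' k' n =
     (if k' = k
      then (if s' = s then (case n of 0 \<Rightarrow> 0 | Suc m \<Rightarrow> Suc (\<rho> s k m)) else Suc (\<rho> s' k n))
      else \<rho> s' k' n)"

fun godel :: "(psort \<Rightarrow> nat \<Rightarrow> nat \<Rightarrow> nat) \<Rightarrow> ('f, 'p) fm \<Rightarrow> ('f, 'p) fm" where
  "godel \<rho> Bot = Bot"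
| "godel \<rho> (Pred P ts) = Pred P ts"
| "godel \<rho> (PVar Ordinary n ts) = PVar Ordinary (\<rho> Ordinary (length ts) n) ts"
| "godel \<rho> (PVar Classical n ts) = Neg (PVar Ordinary (\<rho> Classical (length ts) n) ts)"
| "godel \<rho> (Imp A B) = Imp (godel \<rho> A) (godel \<rho> B)"
| "godel \<rho> (AllT A) = AllT (godel \<rho> A)"
| "godel \<rho> (AllP s k A) = AllP Ordinary k (godel (up_godel s k \<rho>) A)"

text \<open>
  \<open>star k n\<close> is the index of the ordinary variable \<open>X\<^sup>*\<close> of arity \<open>k\<close> associated with the classical
  variable \<open>X\<^sub>C = (Classical, k, n)\<close>; free ordinary variables are left unchanged.
\<close>

definition translation :: "(nat \<Rightarrow> nat \<Rightarrow> nat) \<Rightarrow> ('f, 'p) fm \<Rightarrow> ('f, 'p) fm" where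
  "translation star = godel (\<lambda>s k n. case s of Ordinary \<Rightarrow> n | Classical \<Rightarrow> star k n)"

text \<open>
  Distinct classical variables get distinct associated variables, and these are fresh for the
  formulas in \<open>\<A>\<close>. Freshness for bound variables is automatic with de Bruijn indices.
\<close>

definition fresh_star :: "(nat \<Rightarrow> nat \<Rightarrow> nat) \<Rightarrow> ('f, 'p) fm set \<Rightarrow> bool" where
  "fresh_star star \<A> \<longleftrightarrow>
     (\<forall>k. inj (star k)) \<and> (\<forall>A \<in> \<A>. \<forall>k n. (Ordinary, k, star k n) \<notin> free_pvars A)"

end

theory Submission
  imports Defs
begin

text \<open>
  The claim holds for every index map \<open>\<rho>\<close>, injective or not: identifying free variables of a
  derivation is harmless. All rules but the elimination of \<open>\<forall>X\<^sub>C\<close> are preserved literally. For that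
  one, \<open>X\<^sup>*\<close> is instantiated by \<open>\<not>G\<^sup>*\<close>, which puts \<open>\<not>\<not>G\<^sup>*\<close> where \<open>G\<^sup>*\<close> is wanted; since \<open>G\<close> is a
  classical type, \<open>G\<^sup>*\<close> ends with \<open>\<bottom>\<close>, hence \<open>\<not>\<not>G\<^sup>*\<close> and \<open>G\<^sup>*\<close> are equivalent, and equivalents may
  be exchanged inside a formula.
\<close>

section \<open>Well-formedness\<close>

lemma is_tm_subst_tm:
  "is_tm arf t \<Longrightarrow> (\<And>i. is_tm arf (\<sigma> i)) \<Longrightarrow> is_tm arf (subst_tm \<sigma> t)"
  by (induction t) auto

text \<open>Substitution leaves the function symbols and argument counts of \<open>t\<close> in
  place. This converse direction is used where only an instance or a lifted formula is known to be
  well-formed.\<close>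

lemma is_tm_subst_tmD: "is_tm arf (subst_tm \<sigma> t) \<Longrightarrow> is_tm arf t"
  by (induction t) auto

lemma is_tm_up_tm: "(\<And>i. is_tm arf (\<sigma> i)) \<Longrightarrow> is_tm arf (up_tm \<sigma> i)"
  by (auto simp: up_tm_def is_tm_subst_tm split: nat.split)

lemma lm2_fm_subst_fm:
  "lm2_fm arf arp A \<Longrightarrow> (\<And>i. is_tm arf (\<sigma> i)) \<Longrightarrow> lm2_fm arf arp (subst_fm \<sigma> A)"
  by (induction \<sigma> A rule: subst_fm.induct) (auto simp: is_tm_subst_tm is_tm_up_tm)

lemma lm2_fm_subst_fmD: "lm2_fm arf arp (subst_fm \<sigma> A) \<Longrightarrow> lm2_fm arf arp A"
  by (induction \<sigma> A rule: subst_fm.induct) (auto dest: is_tm_subst_tmD)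

lemma no_classical_subst_fm [simp]: "no_classical (subst_fm \<sigma> A) = no_classical A"
  by (induction \<sigma> A rule: subst_fm.induct) auto

lemma laf2_fm_subst_fm:
  "laf2_fm arf arp A \<Longrightarrow> (\<And>i. is_tm arf (\<sigma> i)) \<Longrightarrow> laf2_fm arf arp (subst_fm \<sigma> A)"
  by (simp add: laf2_fm_def lm2_fm_subst_fm)

lemma laf2_fm_subst_fmD: "laf2_fm arf arp (subst_fm \<sigma> A) \<Longrightarrow> laf2_fm arf arp A"
  by (auto simp: laf2_fm_def dest: lm2_fm_subst_fmD)

lemma laf2_fm_lift_t [simp]: "laf2_fm arf arp (lift_t A) = laf2_fm arf arp A"
  unfolding lift_t_def by (auto intro: laf2_fm_subst_fm dest: laf2_fm_subst_fmD)

lemma laf2_fm_inst_t: "laf2_fm arf arp A \<Longrightarrow> is_tm arf t \<Longrightarrow> laf2_fm arf arp (inst_t t A)"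
  unfolding inst_t_def by (rule laf2_fm_subst_fm) (auto split: nat.split)

lemma lm2_fm_ren_p [simp]: "lm2_fm arf arp (ren_p r A) = lm2_fm arf arp A"
  by (induction r A rule: ren_p.induct) auto

lemma no_classical_ren_p [simp]: "no_classical (ren_p r A) = no_classical A"
  by (induction r A rule: ren_p.induct) auto

lemma laf2_fm_ren_p [simp]: "laf2_fm arf arp (ren_p r A) = laf2_fm arf arp A"
  by (simp add: laf2_fm_def)

lemma laf2_fm_lift_p [simp]: "laf2_fm arf arp (lift_p s k A) = laf2_fm arf arp A"
  by (simp add: lift_p_def)

lemma lm2_fm_pvar_abs [simp]: "lm2_fm arf arp (pvar_abs s k n)"
  by (simp add: pvar_abs_def)

lemma no_classical_pvar_abs [simp]: "no_classical (pvar_abs s k n) = (s = Ordinary)"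
  by (simp add: pvar_abs_def)

lemma lm2_fm_subst_p:
  "lm2_fm arf arp A \<Longrightarrow> (\<And>s k n. lm2_fm arf arp (\<theta> s k n)) \<Longrightarrow> lm2_fm arf arp (subst_p \<theta> A)"
proof (induction \<theta> A rule: subst_p.induct)
  case (3 \<theta> s n ts)
  then show ?case by (auto simp: app_abs_def intro!: lm2_fm_subst_fm)
next
  case (5 \<theta> A)
  have "lm2_fm arf arp (lift_abs k (\<theta> s k n))" for s k n
    unfolding lift_abs_def by (rule lm2_fm_subst_fm) (auto simp: "5.prems")
  then show ?case using 5 by simp
next
  case (6 \<theta> s k A)
  have "lm2_fm arf arp (up_p s k \<theta> s' k' n)" for s' k' n
    using 6 by (auto simp: up_p_def lift_p_def split: nat.split)
  then show ?case using 6 by simp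
qed auto

lemma no_classical_subst_p:
  "no_classical A \<Longrightarrow> (\<And>k n. no_classical (\<theta> Ordinary k n)) \<Longrightarrow> no_classical (subst_p \<theta> A)"
proof (induction \<theta> A rule: subst_p.induct)
  case (3 \<theta> s n ts)
  then show ?case by (auto simp: app_abs_def)
next
  case (5 \<theta> A)
  then show ?case by (auto simp: lift_abs_def)
next
  case (6 \<theta> s k A)
  have "no_classical (up_p s k \<theta> Ordinary k' n)" for k' n
    using 6 by (auto simp: up_p_def lift_p_def split: nat.split)
  then show ?case using 6 by simp
qed auto

lemma lm2_fm_inst_p:
  "lm2_fm arf arp A \<Longrightarrow> lm2_fm arf arp G \<Longrightarrow> lm2_fm arf arp (inst_p s k G A)"
  unfolding inst_p_def by (rule lm2_fm_subst_p) (auto split: nat.split)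

lemma laf2_fm_inst_p:
  "laf2_fm arf arp A \<Longrightarrow> laf2_fm arf arp G \<Longrightarrow> laf2_fm arf arp (inst_p s k G A)"
  unfolding laf2_fm_def
  by (auto intro: lm2_fm_inst_p) (auto simp: inst_p_def intro!: no_classical_subst_p split: nat.split)

lemma laf2_fm_simps [simp]:
  "laf2_fm arf arp Bot"
  "laf2_fm arf arp (PVar s n ts) \<longleftrightarrow> (\<forall>t \<in> set ts. is_tm arf t) \<and> s = Ordinary"
  "laf2_fm arf arp (Imp A B) \<longleftrightarrow> laf2_fm arf arp A \<and> laf2_fm arf arp B"
  "laf2_fm arf arp (AllT A) \<longleftrightarrow> laf2_fm arf arp A"
  "laf2_fm arf arp (AllP s k A) \<longleftrightarrow> s = Ordinary \<and> laf2_fm arf arp A"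
  by (auto simp: laf2_fm_def)

lemma laf2_fm_pvar_abs [simp]: "laf2_fm arf arp (pvar_abs s k n) = (s = Ordinary)"
  by (simp add: laf2_fm_def)

text \<open>Only the equational rule can bring in a term without an explicit \<open>is_tm\<close>
  check, hence the condition on \<open>R\<close>. Its disjunction covers both the identity and
  \<open>eq_conseq\<close>.\<close>

lemma laf2_wf:
  assumes "laf2 arf arp R \<Gamma> A" and "\<And>u v. R u v \<Longrightarrow> u = v \<or> is_tm arf v"
  shows "laf2_fm arf arp A \<and> (\<forall>B \<in> set \<Gamma>. laf2_fm arf arp B)"
  using assms(1)
proof induction
  case (allTE \<Gamma> A t)
  then show ?case by (simp add: laf2_fm_inst_t)
next
  case (allPE \<Gamma> k A G)
  then show ?case by (simp add: laf2_fm_inst_p)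
next
  case (eq \<Gamma> u A v)
  \<comment> \<open>The premise concerns only the instance at \<open>u\<close>; the schema
    \<open>A\<close> is recovered from it before \<open>v\<close> is put in.\<close>
  then have "laf2_fm arf arp A" by (auto simp: inst_t_def dest: laf2_fm_subst_fmD)
  then have "laf2_fm arf arp (inst_t v A)"
    using eq assms(2)[OF eq.hyps(2)] laf2_fm_inst_t[of arf arp A v] by auto
  then show ?case using eq by simp
qed auto

text \<open>The derivation behind \<open>eq_conseq\<close> uses the identity for \<open>R\<close>,
  so \<open>laf2_wf\<close> already applies to it and there is no circularity.\<close>

lemma eq_conseq_is_tm: "eq_conseq arf arp E u v \<Longrightarrow> is_tm arf v"
  by (auto simp: eq_conseq_def Eq_def laf2_fm_def dest!: laf2_wf)

lemma LAF2_wf: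
  assumes "LAF2 arf arp E \<Gamma> A"
  shows "laf2_fm arf arp A" "\<forall>B \<in> set \<Gamma>. laf2_fm arf arp B"
  using laf2_wf[OF assms[unfolded LAF2_def]] eq_conseq_is_tm[of arf arp E] by blast+

section \<open>Substitution\<close>

lemma subst_tm_Var [simp]: "subst_tm Var t = t"
  by (induction t) (auto simp: map_idI)

lemma up_tm_Var [simp]: "up_tm Var = Var"
  by (auto simp: up_tm_def fun_eq_iff split: nat.split)

lemma subst_fm_Var [simp]: "subst_fm Var A = A"
  by (induction A) (auto simp: map_idI)

lemma subst_tm_Var_comp: "subst_tm \<sigma> (subst_tm (\<lambda>i. Var (r i)) t) = subst_tm (\<lambda>i. \<sigma> (r i)) t"
  by (induction t) auto

lemma up_tm_ren: "up_tm (\<lambda>i. Var (r i)) = (\<lambda>i. Var (case_nat 0 (\<lambda>j. Suc (r j)) i))"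
  by (auto simp: up_tm_def fun_eq_iff split: nat.split)

lemma up_tm_comp_ren: "up_tm (\<lambda>i. \<sigma> (r i)) = (\<lambda>i. up_tm \<sigma> (case_nat 0 (\<lambda>j. Suc (r j)) i))"
  by (auto simp: up_tm_def fun_eq_iff split: nat.split)

text \<open>With a renaming as inner substitution, passing under a binder only composes index
  maps.\<close>

lemma subst_fm_ren: "subst_fm \<sigma> (subst_fm (\<lambda>i. Var (r i)) A) = subst_fm (\<lambda>i. \<sigma> (r i)) A"
proof (induction A arbitrary: \<sigma> r)
  case (AllT A)
  then show ?case by (simp add: up_tm_ren up_tm_comp_ren)
qed (auto simp: subst_tm_Var_comp)

text \<open>Under the binder, lifting fixes \<open>0\<close> and sends \<open>j + 1\<close> to
  \<open>j + 2\<close>; instantiating with \<open>Var 0\<close> fixes \<open>0\<close> again and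
  moves every other index back down.\<close>

lemma inst_t_up_lift: "inst_t (Var 0) (subst_fm (up_tm (\<lambda>i. Var (Suc i))) A) = A"
proof -
  have "(\<lambda>i. case_nat (Var 0) Var (case_nat 0 (\<lambda>j. Suc (Suc j)) i)) = Var"
    by (auto simp: fun_eq_iff split: nat.split)
  from arg_cong[OF this, of "\<lambda>\<sigma>. subst_fm \<sigma> A"] show ?thesis
    by (simp add: inst_t_def up_tm_ren subst_fm_ren)
qed

lemma up_p_comp_up_ren:
  "up_p s k (\<lambda>s k n. \<theta> s k (r s k n)) = (\<lambda>s' k' n. up_p s k \<theta> s' k' (up_ren s k r s' k' n))"
  by (auto simp: fun_eq_iff up_p_def up_ren_def split: nat.split)

lemma subst_p_ren_p: "subst_p \<theta> (ren_p r A) = subst_p (\<lambda>s k n. \<theta> s k (r s k n)) A"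
proof (induction A arbitrary: \<theta> r)
  case (AllP s k A)
  then show ?case by (simp add: up_p_comp_up_ren)
qed auto

lemma app_abs_pvar_abs [simp]: "app_abs (pvar_abs s (length ts) n) ts = PVar s n ts"
  by (auto simp: app_abs_def pvar_abs_def intro!: nth_equalityI)

lemma lift_abs_pvar_abs [simp]: "lift_abs k (pvar_abs s k n) = pvar_abs s k n"
  by (auto simp: lift_abs_def pvar_abs_def)

lemma lift_p_pvar_abs:
  "lift_p s k (pvar_abs s' k' n) = pvar_abs s' k' (if s' = s \<and> k' = k then Suc n else n)"
  by (auto simp: lift_p_def pvar_abs_def)

lemma up_p_pvar_abs: "up_p s k pvar_abs = pvar_abs"
  by (auto simp: fun_eq_iff up_p_def lift_p_pvar_abs split: nat.split)

lemma subst_p_pvar_abs: "subst_p pvar_abs A = A"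
  by (induction A) (auto simp: up_p_pvar_abs)

lemma inst_p_up_lift:
  "inst_p s k (pvar_abs s k 0)
     (ren_p (up_ren s k (\<lambda>s' k' n. if s' = s \<and> k' = k then Suc n else n)) A) = A"
proof -
  let ?r = "up_ren s k (\<lambda>s' k' n. if s' = s \<and> k' = k then Suc n else n)"
  have "(\<lambda>s' k' n. if s' = s \<and> k' = k
      then (case ?r s' k' n of 0 \<Rightarrow> pvar_abs s k 0 | Suc m \<Rightarrow> pvar_abs s k m)
      else pvar_abs s' k' (?r s' k' n)) = pvar_abs"
    by (auto simp: fun_eq_iff up_ren_def split: nat.split)
  from arg_cong[OF this, of "\<lambda>\<theta>. subst_p \<theta> A"] show ?thesis
    by (simp add: inst_p_def subst_p_ren_p subst_p_pvar_abs)
qed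

text \<open>De Bruijn form of instantiating \<open>x\<close> by the eigenvariable \<open>x\<close>
  itself: below \<open>allTI\<close>, a lifted universal hypothesis yields its open body.\<close>

lemma allTE_lift:
  assumes "laf2 arf arp R \<Gamma> (lift_t (AllT A))"
  shows "laf2 arf arp R \<Gamma> A"
  using laf2.allTE[OF assms[unfolded lift_t_def subst_fm.simps], of "Var 0"]
  by (simp add: inst_t_up_lift)

lemma allPE_lift:
  assumes "laf2 arf arp R \<Gamma> (lift_p Ordinary k (AllP Ordinary k A))"
  shows "laf2 arf arp R \<Gamma> A"
  using laf2.allPE[OF assms[unfolded lift_p_def ren_p.simps], of "pvar_abs Ordinary k 0"]
  by (simp add: inst_p_up_lift)

section \<open>Stability and replacement\<close>

lemma ending_subst_fm: "ending A = Bot \<Longrightarrow> ending (subst_fm \<sigma> A) = Bot"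
  by (induction \<sigma> A rule: subst_fm.induct) auto

lemma ending_ren_p: "ending A = Bot \<Longrightarrow> ending (ren_p r A) = Bot"
  by (induction r A rule: ren_p.induct) auto

text \<open>Stability passes from a conclusion to an implication and from a body to its
  quantification, starting at \<open>Bot\<close>. The context varies because it is extended and
  lifted on the way.\<close>

lemma stable:
  assumes "laf2_fm arf arp A" "ending A = Bot" "\<forall>B \<in> set \<Gamma>. laf2_fm arf arp B"
  shows "laf2 arf arp R \<Gamma> (Imp (Neg (Neg A)) A)"
  using assms
proof (induction A arbitrary: \<Gamma>)
  case Bot
  let ?\<Gamma> = "Neg (Neg Bot) # \<Gamma>"
  have "laf2 arf arp R ?\<Gamma> (Neg (Neg Bot))"
    using Bot by (auto intro!: laf2.hyp)
  moreover have "laf2 arf arp R ?\<Gamma> (Neg Bot)"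
    using Bot by (auto intro!: laf2.impI laf2.hyp)
  ultimately show ?case by (blast intro: laf2.impI laf2.impE)
next
  case (Imp A B)
  let ?\<Gamma> = "A # Neg (Neg (Imp A B)) # \<Gamma>"
  \<comment> \<open>In the presence of \<open>A\<close>, the assumption \<open>Neg B\<close> refutes
    \<open>Imp A B\<close>, contradicting its double negation; this yields
    \<open>Neg (Neg B)\<close>.\<close>
  let ?\<Delta> = "Imp A B # Neg B # ?\<Gamma>"
  have wf: "\<forall>C \<in> set ?\<Delta>. laf2_fm arf arp C" using Imp.prems by auto
  have "laf2 arf arp R ?\<Delta> (Imp A B)" "laf2 arf arp R ?\<Delta> A" "laf2 arf arp R ?\<Delta> (Neg B)"
    using wf by (auto intro!: laf2.hyp)
  then have "laf2 arf arp R (Neg B # ?\<Gamma>) (Neg (Imp A B))"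
    by (blast intro: laf2.impI laf2.impE)
  moreover have "laf2 arf arp R (Neg B # ?\<Gamma>) (Neg (Neg (Imp A B)))"
    using wf by (auto intro!: laf2.hyp)
  ultimately have "laf2 arf arp R ?\<Gamma> (Neg (Neg B))"
    by (blast intro: laf2.impI laf2.impE)
  moreover have "laf2 arf arp R ?\<Gamma> (Imp (Neg (Neg B)) B)"
    using Imp.prems by (intro Imp.IH) auto
  ultimately show ?case by (blast intro: laf2.impI laf2.impE)
next
  case (AllT A)
  \<comment> \<open>The argument runs inside the scope of the future \<open>allTI\<close>: index
    \<open>0\<close> is the eigenvariable, so \<open>A\<close> is stated as it is while the
    hypotheses are lifted.\<close>
  let ?F = "lift_t (AllT A)"
  let ?\<Gamma> = "Neg (Neg ?F) # map lift_t \<Gamma>"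
  let ?\<Delta> = "?F # Neg A # ?\<Gamma>"
  have wf: "\<forall>C \<in> set ?\<Delta>. laf2_fm arf arp C"
    using AllT.prems by (auto simp del: subst_fm.simps)
  have "laf2 arf arp R ?\<Delta> A"
    by (rule allTE_lift) (use wf in \<open>auto intro!: laf2.hyp\<close>)
  moreover have "laf2 arf arp R ?\<Delta> (Neg A)"
    using wf by (auto intro!: laf2.hyp)
  ultimately have "laf2 arf arp R (Neg A # ?\<Gamma>) (Neg ?F)"
    by (blast intro: laf2.impI laf2.impE)
  moreover have "laf2 arf arp R (Neg A # ?\<Gamma>) (Neg (Neg ?F))"
    using wf by (auto intro!: laf2.hyp)
  ultimately have "laf2 arf arp R ?\<Gamma> (Neg (Neg A))"
    by (blast intro: laf2.impI laf2.impE)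
  moreover have "laf2 arf arp R ?\<Gamma> (Imp (Neg (Neg A)) A)"
    using AllT.prems wf by (intro AllT.IH) auto
  ultimately have "laf2 arf arp R ?\<Gamma> A" by (blast intro: laf2.impE)
  then have "laf2 arf arp R (map lift_t (Neg (Neg (AllT A)) # \<Gamma>)) A"
    by (simp add: lift_t_def)
  then show ?case by (blast intro: laf2.impI laf2.allTI)
next
  case (AllP s k A)
  then have s [simp]: "s = Ordinary" by simp
  let ?F = "lift_p Ordinary k (AllP Ordinary k A)"
  let ?\<Gamma> = "Neg (Neg ?F) # map (lift_p Ordinary k) \<Gamma>"
  let ?\<Delta> = "?F # Neg A # ?\<Gamma>"
  have wf: "\<forall>C \<in> set ?\<Delta>. laf2_fm arf arp C"
    using AllP.prems by auto
  have "laf2 arf arp R ?\<Delta> A"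
    by (rule allPE_lift) (use wf in \<open>auto intro!: laf2.hyp\<close>)
  moreover have "laf2 arf arp R ?\<Delta> (Neg A)"
    using wf by (auto intro!: laf2.hyp)
  ultimately have "laf2 arf arp R (Neg A # ?\<Gamma>) (Neg ?F)"
    by (blast intro: laf2.impI laf2.impE)
  moreover have "laf2 arf arp R (Neg A # ?\<Gamma>) (Neg (Neg ?F))"
    using wf by (auto intro!: laf2.hyp)
  ultimately have "laf2 arf arp R ?\<Gamma> (Neg (Neg A))"
    by (blast intro: laf2.impI laf2.impE)
  moreover have "laf2 arf arp R ?\<Gamma> (Imp (Neg (Neg A)) A)"
    using AllP.prems wf by (intro AllP.IH) auto
  ultimately have "laf2 arf arp R ?\<Gamma> A" by (blast intro: laf2.impE)
  then have "laf2 arf arp R (map (lift_p Ordinary k) (Neg (Neg (AllP Ordinary k A)) # \<Gamma>)) A"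
    by (simp add: lift_p_def)
  then show ?case unfolding s by (blast intro: laf2.impI laf2.allPI)
\<comment> \<open>The remaining atoms do not end with \<open>Bot\<close>.\<close>
qed auto

text \<open>Quantifying over all well-formed contexts builds weakening into the notion, so that it
  can be used directly under added hypotheses and lifted contexts.\<close>

definition provably_equiv ::
    "('f \<Rightarrow> nat) \<Rightarrow> ('p \<Rightarrow> nat) \<Rightarrow> ('f tm \<Rightarrow> 'f tm \<Rightarrow> bool) \<Rightarrow> ('f, 'p) fm \<Rightarrow> ('f, 'p) fm \<Rightarrow> bool" where
  "provably_equiv arf arp R A B \<longleftrightarrow> laf2_fm arf arp A \<and> laf2_fm arf arp B \<and>
     (\<forall>\<Gamma>. (\<forall>C \<in> set \<Gamma>. laf2_fm arf arp C) \<longrightarrow>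
        laf2 arf arp R \<Gamma> (Imp A B) \<and> laf2 arf arp R \<Gamma> (Imp B A))"

lemma provably_equiv_sym: "provably_equiv arf arp R A B \<Longrightarrow> provably_equiv arf arp R B A"
  by (auto simp: provably_equiv_def)

lemma provably_equiv_refl: "laf2_fm arf arp A \<Longrightarrow> provably_equiv arf arp R A A"
  by (auto simp: provably_equiv_def intro!: laf2.impI laf2.hyp)

lemma provably_equiv_Neg_Neg:
  assumes "laf2_fm arf arp A" "ending A = Bot"
  shows "provably_equiv arf arp R A (Neg (Neg A))"
proof -
  have "laf2 arf arp R \<Gamma> (Imp A (Neg (Neg A)))" if "\<forall>C \<in> set \<Gamma>. laf2_fm arf arp C" for \<Gamma>
  proof -
    have "laf2 arf arp R (Neg A # A # \<Gamma>) (Neg A)" "laf2 arf arp R (Neg A # A # \<Gamma>) A"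
      using that assms by (auto intro!: laf2.hyp)
    then show ?thesis by (blast intro: laf2.impI laf2.impE)
  qed
  then show ?thesis using assms by (auto simp: provably_equiv_def intro: stable)
qed

lemma provably_equiv_Imp:
  assumes "provably_equiv arf arp R A A'" "provably_equiv arf arp R B B'"
  shows "provably_equiv arf arp R (Imp A B) (Imp A' B')"
proof -
  \<comment> \<open>One direction is shown for arbitrary equivalents; the other comes from the
    symmetric equivalences.\<close>
  have "laf2 arf arp R \<Gamma> (Imp (Imp A B) (Imp A' B'))"
    if "provably_equiv arf arp R A A'" "provably_equiv arf arp R B B'"
      "\<forall>C \<in> set \<Gamma>. laf2_fm arf arp C" for A A' B B' \<Gamma>
  proof -
    let ?\<Gamma> = "A' # Imp A B # \<Gamma>"
    have wf: "\<forall>C \<in> set ?\<Gamma>. laf2_fm arf arp C" using that by (auto simp: provably_equiv_def)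
    then have "laf2 arf arp R ?\<Gamma> A'" "laf2 arf arp R ?\<Gamma> (Imp A B)"
      by (auto intro!: laf2.hyp)
    moreover have "laf2 arf arp R ?\<Gamma> (Imp A' A)" "laf2 arf arp R ?\<Gamma> (Imp B B')"
      using that wf unfolding provably_equiv_def by blast+
    ultimately show ?thesis by (blast intro: laf2.impI laf2.impE)
  qed
  from this[OF assms] this[OF assms[THEN provably_equiv_sym]] assms show ?thesis
    by (auto simp: provably_equiv_def)
qed

lemma provably_equiv_AllT:
  assumes "provably_equiv arf arp R A A'"
  shows "provably_equiv arf arp R (AllT A) (AllT A')"
proof -
  have "laf2 arf arp R \<Gamma> (Imp (AllT A) (AllT A'))"
    if "provably_equiv arf arp R A A'" "\<forall>C \<in> set \<Gamma>. laf2_fm arf arp C" for A A' \<Gamma>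
  proof -
    let ?\<Gamma> = "map lift_t (AllT A # \<Gamma>)"
    have wf: "\<forall>C \<in> set ?\<Gamma>. laf2_fm arf arp C" using that by (auto simp: provably_equiv_def)
    have "laf2 arf arp R ?\<Gamma> A"
      by (rule allTE_lift) (use wf in \<open>auto intro!: laf2.hyp\<close>)
    moreover have "laf2 arf arp R ?\<Gamma> (Imp A A')"
      using that wf unfolding provably_equiv_def by blast
    ultimately show ?thesis by (blast intro: laf2.impI laf2.impE laf2.allTI)
  qed
  from this[OF assms] this[OF assms[THEN provably_equiv_sym]] assms show ?thesis
    by (auto simp: provably_equiv_def)
qed

lemma provably_equiv_AllP:
  assumes "provably_equiv arf arp R A A'"
  shows "provably_equiv arf arp R (AllP Ordinary k A) (AllP Ordinary k A')"
proof -
  have "laf2 arf arp R \<Gamma> (Imp (AllP Ordinary k A) (AllP Ordinary k A'))"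
    if "provably_equiv arf arp R A A'" "\<forall>C \<in> set \<Gamma>. laf2_fm arf arp C" for A A' \<Gamma>
  proof -
    let ?\<Gamma> = "map (lift_p Ordinary k) (AllP Ordinary k A # \<Gamma>)"
    have wf: "\<forall>C \<in> set ?\<Gamma>. laf2_fm arf arp C" using that by (auto simp: provably_equiv_def)
    have "laf2 arf arp R ?\<Gamma> A"
      by (rule allPE_lift) (use wf in \<open>auto intro!: laf2.hyp\<close>)
    moreover have "laf2 arf arp R ?\<Gamma> (Imp A A')"
      using that wf unfolding provably_equiv_def by blast
    ultimately show ?thesis by (blast intro: laf2.impI laf2.impE laf2.allPI)
  qed
  from this[OF assms] this[OF assms[THEN provably_equiv_sym]] assms show ?thesis
    by (auto simp: provably_equiv_def)
qed

section \<open>The translation\<close>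

lemma lm2_fm_godel [simp]: "lm2_fm arf arp (godel \<rho> A) = lm2_fm arf arp A"
  by (induction \<rho> A rule: godel.induct) auto

lemma no_classical_godel [simp]: "no_classical (godel \<rho> A)"
  by (induction \<rho> A rule: godel.induct) auto

lemma laf2_fm_godel [simp]: "laf2_fm arf arp (godel \<rho> A) = lm2_fm arf arp A"
  by (simp add: laf2_fm_def)

text \<open>A final classical variable turns into a negation, and a final \<open>Bot\<close>
  stays.\<close>

lemma ending_godel: "classical_type A \<Longrightarrow> ending (godel \<rho> A) = Bot"
  by (induction \<rho> A rule: godel.induct) (auto simp: classical_type_def)

lemma godel_subst_fm: "godel \<rho> (subst_fm \<sigma> A) = subst_fm \<sigma> (godel \<rho> A)"
  by (induction \<rho> A arbitrary: \<sigma> rule: godel.induct) auto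

text \<open>Only \<open>r' Ordinary\<close> matters, since translated formulas contain ordinary
  variables alone. The index equation is preserved when all four maps pass under a binder.\<close>

lemma godel_ren_p:
  "(\<And>s k n. \<rho>' s k (r s k n) = r' Ordinary k (\<rho> s k n)) \<Longrightarrow>
    godel \<rho>' (ren_p r A) = ren_p r' (godel \<rho> A)"
proof (induction \<rho> A arbitrary: \<rho>' r r' rule: godel.induct)
  case (7 \<rho> s k A)
  then show ?case by (auto simp: up_godel_def up_ren_def split: nat.split intro!: "7.IH")
qed auto

text \<open>\<open>lift_p s k\<close> leaves variables of the other sort alone, but
  \<open>up_godel\<close> shifts those of arity \<open>k\<close> as well, so the result is a full
  lift of the merged index space. This carries eigenvariable conditions over.\<close>

lemma godel_lift_p: "godel (up_godel s k \<rho>) (lift_p s k A) = lift_p Ordinary k (godel \<rho> A)"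
  unfolding lift_p_def by (rule godel_ren_p) (auto simp: up_godel_def)

text \<open>
  Relates the translation \<open>D\<close> of what replaces a variable to what replaces its translation. The last
  alternative is a classical variable instantiated by a classical type. Unlike provable equivalence,
  this is closed under substitution and renaming without any work on derivations.
\<close>

definition image_rel :: "('f \<Rightarrow> nat) \<Rightarrow> ('p \<Rightarrow> nat) \<Rightarrow> psort \<Rightarrow> ('f, 'p) fm \<Rightarrow> ('f, 'p) fm \<Rightarrow> bool" where
  "image_rel arf arp s D T \<longleftrightarrow> laf2_fm arf arp D \<and> (case s of
     Ordinary \<Rightarrow> D = T | Classical \<Rightarrow> D = Neg T \<or> T = Neg D \<and> ending D = Bot)"

lemma image_rel_subst_fm:
  "image_rel arf arp s D T \<Longrightarrow> (\<And>i. is_tm arf (\<sigma> i)) \<Longrightarrow>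
    image_rel arf arp s (subst_fm \<sigma> D) (subst_fm \<sigma> T)"
  by (auto simp: image_rel_def laf2_fm_subst_fm ending_subst_fm split: psort.splits)

lemma image_rel_lift_p:
  "image_rel arf arp s D T \<Longrightarrow> image_rel arf arp s (lift_p s' k D) (lift_p s' k T)"
  by (auto simp: image_rel_def lift_p_def ending_ren_p split: psort.splits)

text \<open>Handles variables that are kept: a classical one falls under the alternative
  \<open>D = Neg T\<close>.\<close>

lemma image_rel_pvar_abs:
  "image_rel arf arp s (godel \<rho> (pvar_abs s k n)) (pvar_abs Ordinary k (\<rho> s k n))"
  by (cases s) (auto simp: image_rel_def pvar_abs_def laf2_fm_def)

text \<open>Equality can fail only at a classical atom with \<open>T = Neg D\<close>, where
  \<open>D\<close> faces \<open>Neg (Neg D)\<close>; stability settles this, and congruence carries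
  it through the connectives.\<close>

lemma godel_subst_p:
  assumes "lm2_fm arf arp A"
    and "\<And>s k n. image_rel arf arp s (godel \<rho> (\<theta> s k n)) (\<theta>' Ordinary k (\<rho>' s k n))"
  shows "provably_equiv arf arp R (godel \<rho> (subst_p \<theta> A)) (subst_p \<theta>' (godel \<rho>' A))"
  using assms
proof (induction A arbitrary: \<rho> \<rho>' \<theta> \<theta>')
  case (PVar s n ts)
  have "image_rel arf arp s (app_abs (godel \<rho> (\<theta> s (length ts) n)) ts)
      (app_abs (\<theta>' Ordinary (length ts) (\<rho>' s (length ts) n)) ts)"
    unfolding app_abs_def using PVar by (auto intro!: image_rel_subst_fm)
  then show ?case
    by (cases s) (auto simp: image_rel_def app_abs_def godel_subst_fm
        intro!: provably_equiv_refl provably_equiv_Neg_Neg)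
next
  case (AllT A)
  then have "image_rel arf arp s (godel \<rho> (lift_abs k (\<theta> s k n)))
      (lift_abs k (\<theta>' Ordinary k (\<rho>' s k n)))" for s k n
    unfolding lift_abs_def godel_subst_fm by (intro image_rel_subst_fm) auto
  then show ?case using AllT by (auto intro!: provably_equiv_AllT AllT.IH)
next
  case (AllP s k A)
  have lift: "image_rel arf arp s' (godel (up_godel s k \<rho>) (lift_p s k (\<theta> s' k' n)))
      (lift_p Ordinary k (\<theta>' Ordinary k' (\<rho>' s' k' n)))" for s' k' n
    unfolding godel_lift_p by (intro image_rel_lift_p AllP.prems)
  have zero: "image_rel arf arp s (godel (up_godel s k \<rho>) (pvar_abs s k 0)) (pvar_abs Ordinary k 0)"
    using image_rel_pvar_abs[of arf arp s "up_godel s k \<rho>" k 0] by (simp add: up_godel_def)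
  \<comment> \<open>The bound variable has index \<open>0\<close> on both sides
    (\<open>zero\<close>). Every other variable of arity \<open>k\<close>, of either sort, has a
    successor index after \<open>up_godel\<close>, so \<open>up_p\<close> lifts its image
    (\<open>lift\<close>).\<close>
  have "image_rel arf arp s' (godel (up_godel s k \<rho>) (up_p s k \<theta> s' k' n))
      (up_p Ordinary k \<theta>' Ordinary k' (up_godel s k \<rho>' s' k' n))" for s' k' n
    using lift zero by (auto simp: up_p_def up_godel_def split: nat.split)
  then show ?case using AllP by (auto intro!: provably_equiv_AllP AllP.IH)
qed (auto intro: provably_equiv_refl provably_equiv_Imp simp: laf2_fm_def)

text \<open>\<open>up_godel\<close> reserves index \<open>0\<close> for the instantiated variable
  and gives all others of arity \<open>k\<close> successor indices, so \<open>T\<close> replaces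
  nothing else even if \<rho> identifies variables.\<close>

lemma godel_inst_p:
  assumes "lm2_fm arf arp A" "image_rel arf arp s (godel \<rho> G) T"
  shows "provably_equiv arf arp R (godel \<rho> (inst_p s k G A))
    (inst_p Ordinary k T (godel (up_godel s k \<rho>) A))"
  unfolding inst_p_def
  by (rule godel_subst_p)
    (use assms image_rel_pvar_abs in \<open>auto simp: up_godel_def split: nat.split\<close>)

text \<open>Common treatment of both predicate eliminations: instantiate by \<open>T\<close> in
  LAF2, then exchange the result for its equivalent.\<close>

lemma LAF2_inst_p_godel:
  assumes "LAF2 arf arp E \<Gamma> (godel \<rho> (AllP s k A))" "image_rel arf arp s (godel \<rho> G) T"
    and "laf2_fm arf arp T"
  shows "LAF2 arf arp E \<Gamma> (godel \<rho> (inst_p s k G A))"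
proof -
  let ?R = "eq_conseq arf arp E"
  have "laf2 arf arp ?R \<Gamma> (inst_p Ordinary k T (godel (up_godel s k \<rho>) A))"
    using assms by (auto simp: LAF2_def intro: laf2.allPE)
  moreover have "provably_equiv arf arp ?R (godel \<rho> (inst_p s k G A))
      (inst_p Ordinary k T (godel (up_godel s k \<rho>) A))"
    using LAF2_wf(1)[OF assms(1)] assms(2) by (intro godel_inst_p) auto
  ultimately show ?thesis
    using LAF2_wf(2)[OF assms(1)] unfolding LAF2_def provably_equiv_def by (blast intro: laf2.impE)
qed

lemma LM2_godel:
  "LM2 arf arp E \<Gamma> A \<Longrightarrow> LAF2 arf arp E (map (godel \<rho>) \<Gamma>) (godel \<rho> A)"
proof (induction arbitrary: \<rho> rule: LM2.induct)
  case (hyp A \<Gamma>)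
  then show ?case by (auto simp: LAF2_def intro!: laf2.hyp)
next
  case (impI A \<Gamma> B)
  then show ?case by (auto simp: LAF2_def intro: laf2.impI)
next
  case (impE \<Gamma> A B)
  then show ?case by (auto simp: LAF2_def intro: laf2.impE)
next
  case (allTI \<Gamma> A)
  then show ?case
    by (auto simp: LAF2_def lift_t_def godel_subst_fm o_def intro!: laf2.allTI)
next
  case (allTE \<Gamma> A t)
  then show ?case
    using laf2.allTE[of arf arp "eq_conseq arf arp E" "map (godel \<rho>) \<Gamma>" "godel \<rho> A" t]
    by (simp add: LAF2_def inst_t_def godel_subst_fm)
next
  case (allPI k \<Gamma> A)
  \<comment> \<open>At this index map the translated lifted hypotheses are the lifts of the
    translated ones.\<close>
  from this(2)[of "up_godel Ordinary k \<rho>"] show ?case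
    by (auto simp: LAF2_def godel_lift_p o_def intro!: laf2.allPI)
next
  case (allPE \<Gamma> k A G)
  then show ?case
    by (intro LAF2_inst_p_godel[where T = "godel \<rho> G"]) (auto simp: image_rel_def)
next
  case (eq \<Gamma> u A v)
  then show ?case
    using laf2.eq[of arf arp "eq_conseq arf arp E" "map (godel \<rho>) \<Gamma>" u "godel \<rho> A" v]
    by (auto simp: LAF2_def inst_t_def godel_subst_fm)
next
  case (dneg \<Gamma>)
  then show ?case
    by (auto simp: LAF2_def up_godel_def intro!: laf2.allPI stable)
next
  case (allCI k \<Gamma> A)
  from this(2)[of "up_godel Classical k \<rho>"] show ?case
    by (auto simp: LAF2_def godel_lift_p o_def intro!: laf2.allPI)
next
  case (allCE \<Gamma> k A G)
  then show ?case
    by (intro LAF2_inst_p_godel[where T = "Neg (godel \<rho> G)"]) (auto simp: image_rel_def ending_godel)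
qed

theorem theorem3p2:
  fixes arf :: "'f \<Rightarrow> nat" and arp :: "'p \<Rightarrow> nat"
    and E :: "('f tm \<times> 'f tm) set"
    and star :: "nat \<Rightarrow> nat \<Rightarrow> nat"
    and As :: "('f, 'p) fm list" and A :: "('f, 'p) fm"
  assumes "\<forall>(u, v) \<in> E. is_tm arf u \<and> is_tm arf v"
    and "\<forall>B \<in> set (A # As). lm2_fm arf arp B"
    and "fresh_star star (set (A # As))"
    and "LM2 arf arp E As A"
  shows "LAF2 arf arp E (map (translation star) As) (translation star A)"
  unfolding translation_def using assms(4) by (rule LM2_godel)

end
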